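(* Let $p\ge1$ and $n\ge 2p$ be integers. For all $U\in\mathrm{St}(n,p)$ and all $\delta\in[0,2]$, there is $\widetilde U\in\mathrm{St}(n,p)$ with $\|U-\widetilde U\|_{\mathrm F}=\delta$ such that $$d_{\mathrm E}(U,\widetilde U)=2\arcsin\left(\frac{\|U-\widetilde U\|_{\mathrm F}}{2}\right).$$ Said otherwise, $\widehat M_{\mathrm E}(\delta)=M_{\mathrm E}(\delta)$ for all $\delta\in[0,2]$.
   Context: The Stiefel manifold is $\mathrm{St}(n,p)=\{U\in\mathbb{R}^{n\times p} : U^TU=I_p\}$, and $\|\cdot\|_{\mathrm F}$ is the Frobenius norm. The Euclidean geodesic distance on $\mathrm{St}(n,p)$ (induced by the metric inherited from $\mathbb{R}^{n\times p}$ with the Frobenius inner product) is $d_{\mathrm E}(U,\widetilde U)=\inf_\gamma\int_0^1\|\dot\gamma(t)\|_{\mathrm F}\,dt$, the infimum being over continuously differentiable curves $\gamma:[0,1]\to\mathrm{St}(n,p)$ with $\gamma(0)=U$, $\gamma(1)=\widetilde U$. For $\delta\in[0,2\sqrt p]$, $M_{\mathrm E}(\delta):=\max\{d_{\mathrm E}(U,\widetilde U) : U,\widetilde U\in\mathrm{St}(n,p),\ \|\widetilde U-U\|_{\mathrm F}=\delta\}$, and $\widehat M_{\mathrm E}(\delta):=2\arcsin(\delta/2)$ if $\delta\le2$, $\widehat M_{\mathrm E}(\delta):=\frac{\pi}{2}\delta$ otherwise. *)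

theory Defs
  imports "HOL-Analysis.Analysis"
begin

text \<open>
  An \<open>n \<times> p\<close> matrix is an element of \<open>real ^ 'p ^ 'n\<close> with \<open>n = CARD('n)\<close> and \<open>p = CARD('p)\<close>
  (so \<open>n, p \<ge> 1\<close> is built in). The library norm and inner product on this type are the Frobenius
  ones; they are used throughout.
\<close>

lemma norm_eq_frobenius:
  fixes A :: "real ^ 'p ^ 'n"
  shows "norm A = sqrt (\<Sum>i\<in>UNIV. \<Sum>j\<in>UNIV. (A $ i $ j)\<^sup>2)"
  by (simp add: norm_vec_def L2_set_def sum_nonneg)

definition stiefel :: "(real ^ 'p ^ 'n) set" where
  "stiefel = {U. transpose U ** U = mat 1}"

text \<open>
  Derivatives are taken within \<open>{0..1}\<close>, i.e. one-sided at the end points; the values of the curve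
  outside \<open>{0..1}\<close> are irrelevant.
\<close>

definition C1_curve :: "(real \<Rightarrow> 'a::euclidean_space) \<Rightarrow> bool" where
  "C1_curve \<gamma> \<longleftrightarrow> \<gamma> differentiable_on {0..1} \<and>
     continuous_on {0..1} (\<lambda>t. vector_derivative \<gamma> (at t within {0..1}))"

definition curve_length :: "(real \<Rightarrow> 'a::euclidean_space) \<Rightarrow> real" where
  "curve_length \<gamma> = integral {0..1} (\<lambda>t. norm (vector_derivative \<gamma> (at t within {0..1})))"

text \<open>
  The infimum is the real one, hence meaningful when some admissible curve joins \<open>U\<close> to \<open>V\<close>. This
  is always so if \<open>p < n\<close>, as the Stiefel manifold is then connected.
\<close>

definition dist_E :: "real ^ 'p ^ 'n \<Rightarrow> real ^ 'p ^ 'n \<Rightarrow> real" where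
  "dist_E U V = Inf {curve_length \<gamma> | \<gamma>.
     C1_curve \<gamma> \<and> \<gamma> ` {0..1} \<subseteq> stiefel \<and> \<gamma> 0 = U \<and> \<gamma> 1 = V}"

text \<open>The type arguments fix \<open>n\<close> and \<open>p\<close>, which cannot be read off from \<open>\<delta>\<close>.\<close>

definition dists_E :: "'n::finite itself \<Rightarrow> 'p::finite itself \<Rightarrow> real \<Rightarrow> real set" where
  "dists_E _ _ \<delta> = {dist_E U V | U V :: real ^ 'p ^ 'n.
     U \<in> stiefel \<and> V \<in> stiefel \<and> norm (V - U) = \<delta>}"

text \<open>
  \<open>GREATEST\<close> is the maximum of the (infinite) set of distances; it is unspecified if there is none.
\<close>

definition M_E :: "'n::finite itself \<Rightarrow> 'p::finite itself \<Rightarrow> real \<Rightarrow> real" where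
  "M_E n p \<delta> = (GREATEST d. d \<in> dists_E n p \<delta>)"

definition M_E_hat :: "real \<Rightarrow> real" where
  "M_E_hat \<delta> = (if \<delta> \<le> 2 then 2 * arcsin (\<delta> / 2) else pi / 2 * \<delta>)"

end

(*
  Upper bound.  Diagonalising the symmetric matrix U^T V + V^T U by an orthogonal change of the
  columns makes the column-wise normalised chord from U to V stay on the Stiefel manifold; it also
  gives a midpoint M.  The superadditivity of x |-> 1 - sqrt (1 - x) shows that if U and V are at
  chordal distance at most 2 sin a, then U, M and M, V are at chordal distance at most 2 sin (a/2).
  Bisecting k times and joining consecutive points by normalised chords gives a curve of length
  2^k * 2 tan (a / 2^k), which tends to 2 a.

  Lower bound.  A curve on the manifold is at least as long as the spherical curve traced by one of
  its columns.  If only one column of U is rotated by the angle t, then the distance is exactly t,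
  whereas the chordal distance is 2 sin (t/2).
*)
theory Submission
  imports Defs
begin

section \<open>Orthonormal eigenbases of self-adjoint maps\<close>

text \<open>By compactness the Rayleigh quotient has a maximiser on the unit sphere of
  \<open>W\<close>, and such a maximiser is an eigenvector. Working in an invariant subspace lets
  the construction of an eigenbasis restart in orthogonal complements.\<close>

lemma self_adjoint_eigenvector:
  fixes f :: "'a::euclidean_space \<Rightarrow> 'a"
  assumes lin: "linear f" and sa: "\<And>x y. f x \<bullet> y = x \<bullet> f y"
    and W: "subspace W" "W \<noteq> {0}" and inv: "f ` W \<subseteq> W"
  obtains x c where "x \<in> W" "norm x = 1" "f x = c *\<^sub>R x"
proof -
  interpret linear f by fact
  define K where "K = W \<inter> sphere 0 1"
  obtain z where z: "z \<in> W" "z \<noteq> 0"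
    using W subspace_0 by blast
  then have "z /\<^sub>R norm z \<in> K"
    using W(1) by (auto simp: K_def subspace_scale)
  moreover have "compact K"
    unfolding K_def using W(1) by (simp add: closed_Int_compact closed_subspace)
  moreover have "continuous_on K (\<lambda>x. x \<bullet> f x)"
    using lin by (intro continuous_on_inner continuous_on_id linear_continuous_on) (simp add: linear_linear)
  ultimately obtain x where x: "x \<in> K" and max: "\<And>y. y \<in> K \<Longrightarrow> y \<bullet> f y \<le> x \<bullet> f x"
    using continuous_attains_sup[of K "\<lambda>x. x \<bullet> f x"] by auto
  define c where "c = x \<bullet> f x"
  have xW: "x \<in> W" and nx: "norm x = 1" using x by (auto simp: K_def)
  have hom: "y \<bullet> f y \<le> c * (y \<bullet> y)" if "y \<in> W" for y
  proof (cases "y = 0")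
    case False
    then have "y /\<^sub>R norm y \<in> K" using that W(1) by (auto simp: K_def subspace_scale)
    from max[OF this] have "(y \<bullet> f y) / (norm y)\<^sup>2 \<le> c"
      using False by (simp add: c_def scale power2_eq_square divide_inverse mult_ac)
    with False show ?thesis by (simp add: divide_le_eq dot_square_norm)
  qed (simp add: zero)
  \<comment> \<open>The first variation of the Rayleigh quotient at its maximiser \<open>x\<close>, in the direction \<open>w\<close>.\<close>
  define w where "w = f x - c *\<^sub>R x"
  have wW: "w \<in> W" using xW inv W(1) by (auto simp: w_def subspace_diff subspace_scale)
  have xx: "x \<bullet> x = 1" using nx by (simp add: dot_square_norm)
  define b where "b = w \<bullet> f w - c * (w \<bullet> w)"
  have quad: "2 * t * (w \<bullet> w) + t\<^sup>2 * b \<le> 0" for t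
  proof -
    have "x + t *\<^sub>R w \<in> W" using xW wW W(1) by (simp add: subspace_add subspace_scale)
    from hom[OF this]
    have *: "c + 2 * t * (w \<bullet> f x) + t\<^sup>2 * (w \<bullet> f w) \<le> c * (1 + 2 * t * (w \<bullet> x) + t\<^sup>2 * (w \<bullet> w))"
      using sa[of x w] sa[of w x]
      by (simp add: add scale inner_simps xx c_def[symmetric] inner_commute power2_eq_square algebra_simps)
    have ww: "w \<bullet> w = w \<bullet> f x - c * (w \<bullet> x)"
      unfolding w_def by (simp add: inner_simps)
    have "2 * t * (w \<bullet> w) = 2 * t * (w \<bullet> f x) - c * (2 * t * (w \<bullet> x))"
      by (subst ww) (simp add: algebra_simps)
    with * show ?thesis by (simp add: b_def algebra_simps)
  qed
  have "w \<bullet> w = 0"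
  proof (rule ccontr)
    assume "w \<bullet> w \<noteq> 0"
    then have p: "w \<bullet> w > 0" by simp
    \<comment> \<open>Chosen so that \<open>t * \<bar>b\<bar>\<close> is at most
      \<open>w \<bullet> w\<close>: the term of \<open>quad\<close> that is linear in
      \<open>t\<close> then outweighs the quadratic one.\<close>
    define t where "t = (w \<bullet> w) / (\<bar>b\<bar> + 1)"
    have t: "t > 0" using p by (simp add: t_def add_nonneg_pos)
    have "t * \<bar>b\<bar> \<le> t * (\<bar>b\<bar> + 1)" using t by simp
    also have "\<dots> = w \<bullet> w" by (simp add: t_def add_nonneg_pos field_simps)
    finally have "t * (- b) < 2 * (w \<bullet> w)" using p t
      by (smt (verit) mult_left_mono)
    then have "0 < t * (2 * (w \<bullet> w) + t * b)" using t by simp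
    with quad[of t] show False by (simp add: power2_eq_square algebra_simps)
  qed
  then have "f x = c *\<^sub>R x" by (simp add: w_def)
  with xW nx show ?thesis using that by blast
qed

text \<open>Unit eigenvectors are added one at a time: the orthogonal complement of those already
  found is invariant because \<open>f\<close> is self-adjoint, and it is nonzero as long as there
  are fewer than \<open>CARD('p)\<close> of them.\<close>

lemma self_adjoint_orthonormal_eigenbasis:
  fixes f :: "real^'p \<Rightarrow> real^'p"
  assumes lin: "linear f" and sa: "\<And>x y. f x \<bullet> y = x \<bullet> f y"
  obtains q :: "'p \<Rightarrow> real^'p" and c where
    "\<And>i j. q i \<bullet> q j = (if i = j then 1 else 0)" "\<And>i. f (q i) = c i *\<^sub>R q i"
proof -
  have "\<exists>B. finite B \<and> card B = k \<and> pairwise orthogonal B \<and> (\<forall>x\<in>B. norm x = 1 \<and> (\<exists>c. f x = c *\<^sub>R x))"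
    if "k \<le> CARD('p)" for k
    using that
  proof (induction k)
    case 0
    show ?case by (intro exI[of _ "{}"]) auto
  next
    case (Suc k)
    then obtain B where B: "finite B" "card B = k" "pairwise orthogonal B"
      "\<And>x. x \<in> B \<Longrightarrow> norm x = 1" "\<And>x. x \<in> B \<Longrightarrow> \<exists>c. f x = c *\<^sub>R x"
      by auto
    define W where "W = {y. \<forall>x\<in>B. x \<bullet> y = 0}"
    have "dim B < DIM(real^'p)"
      using dim_le_card'[OF B(1)] B(2) Suc.prems by simp
    then obtain z where "z \<noteq> 0" "\<And>y. y \<in> span B \<Longrightarrow> orthogonal z y"
      by (rule orthogonal_to_subspace_exists) blast
    then have "W \<noteq> {0}"
      by (auto simp: W_def orthogonal_def inner_commute set_eq_iff span_base intro!: exI[of _ z])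
    moreover have "subspace W"
      by (auto simp: W_def subspace_def inner_simps)
    moreover have "f ` W \<subseteq> W"
    proof (auto simp: W_def)
      fix y x assume y: "\<forall>x\<in>B. x \<bullet> y = 0" and x: "x \<in> B"
      obtain c where "f x = c *\<^sub>R x" using B(5)[OF x] by auto
      then show "x \<bullet> f y = 0" using y x by (simp flip: sa)
    qed
    ultimately obtain x c where x: "x \<in> W" "norm x = 1" "f x = c *\<^sub>R x"
      using self_adjoint_eigenvector[OF lin sa] by metis
    have "x \<notin> B" using x B(4) by (fastforce simp: W_def dot_square_norm)
    moreover have "orthogonal x y \<and> orthogonal y x" if "y \<in> B" for y
      using x(1) that by (auto simp: W_def orthogonal_def inner_commute)
    ultimately show ?case using B x(2,3)
      by (intro exI[of _ "insert x B"]) (auto simp: pairwise_insert)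
  qed
  from this[of "CARD('p)"] obtain B :: "(real^'p) set" where B: "finite B" "card B = CARD('p)" "pairwise orthogonal B"
      "\<And>x. x \<in> B \<Longrightarrow> norm x = 1" "\<And>x. x \<in> B \<Longrightarrow> \<exists>c. f x = c *\<^sub>R x"
    by auto
  obtain q where q: "bij_betw q (UNIV :: 'p set) B"
    using finite_same_card_bij[of "UNIV :: 'p set" B] B by auto
  have qB: "q i \<in> B" for i using q by (auto simp: bij_betw_def)
  obtain c where c: "\<And>i. f (q i) = c i *\<^sub>R q i" using B(5)[OF qB] by metis
  have "q i \<bullet> q j = (if i = j then 1 else 0)" for i j
    using B(3,4) qB[of i] qB[of j] q
    by (auto simp: pairwise_def orthogonal_def bij_betw_def inj_eq dot_square_norm)
  with c show ?thesis using that by blast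
qed

section \<open>Concatenating continuously differentiable curves\<close>

text \<open>
  The curves live on the whole line and are constant outside \<open>{0..1}\<close>, so that two of them can be
  concatenated by a sum, without case distinctions; \<open>l\<close> majorises the arc length, which avoids
  integrals until the very end.
\<close>

definition joinable :: "'a::euclidean_space set \<Rightarrow> 'a \<Rightarrow> 'a \<Rightarrow> real \<Rightarrow> bool" where
  "joinable S x y L \<longleftrightarrow> (\<exists>\<gamma> \<gamma>' l l'.
     (\<forall>t. (\<gamma> has_vector_derivative \<gamma>' t) (at t)) \<and> continuous_on UNIV \<gamma>' \<and>
     (\<forall>t. (l has_real_derivative l' t) (at t)) \<and> (\<forall>t. norm (\<gamma>' t) \<le> l' t) \<and> range \<gamma> \<subseteq> S \<and>
     (\<forall>t\<le>0. \<gamma> t = x \<and> l t = 0) \<and> (\<forall>t\<ge>1. \<gamma> t = y \<and> l t = L))"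

lemma joinableE:
  assumes "joinable S x y L"
  obtains \<gamma> \<gamma>' l l' where
    "\<And>t. (\<gamma> has_vector_derivative \<gamma>' t) (at t)" "continuous_on UNIV \<gamma>'"
    "\<And>t. (l has_real_derivative l' t) (at t)" "\<And>t. norm (\<gamma>' t) \<le> l' t" "range \<gamma> \<subseteq> S"
    "\<And>t. t \<le> 0 \<Longrightarrow> \<gamma> t = x" "\<And>t. t \<le> 0 \<Longrightarrow> l t = 0"
    "\<And>t. t \<ge> 1 \<Longrightarrow> \<gamma> t = y" "\<And>t. t \<ge> 1 \<Longrightarrow> l t = L"
  using assms unfolding joinable_def by blast

lemma joinable_trans:
  assumes "joinable S x y a" "joinable S y z b"
  shows "joinable S x z (a + b)"
proof -
  obtain g g' l l' where g:
     "\<And>t. (g has_vector_derivative g' t) (at t)" "continuous_on UNIV g'"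
     "\<And>t. (l has_real_derivative l' t) (at t)" "\<And>t. norm (g' t) \<le> l' t" "range g \<subseteq> S"
     "\<And>t. t\<le>0 \<Longrightarrow> g t = x" "\<And>t. t\<le>0 \<Longrightarrow> l t = 0" "\<And>t. t\<ge>1 \<Longrightarrow> g t = y" "\<And>t. t\<ge>1 \<Longrightarrow> l t = a"
    using assms(1) by (rule joinableE) blast
  obtain h h' m m' where h:
     "\<And>t. (h has_vector_derivative h' t) (at t)" "continuous_on UNIV h'"
     "\<And>t. (m has_real_derivative m' t) (at t)" "\<And>t. norm (h' t) \<le> m' t" "range h \<subseteq> S"
     "\<And>t. t\<le>0 \<Longrightarrow> h t = y" "\<And>t. t\<le>0 \<Longrightarrow> m t = 0" "\<And>t. t\<ge>1 \<Longrightarrow> h t = z" "\<And>t. t\<ge>1 \<Longrightarrow> m t = b"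
    using assms(2) by (rule joinableE) blast
  \<comment> \<open>Up to time 1/2 the summand from \<open>h\<close> rests at \<open>y\<close>,
    afterwards the one from \<open>g\<close> does; subtracting \<open>y\<close> leaves the moving
    summand.\<close>
  define \<gamma> where "\<gamma> t = g (2 * t) + h (2 * t - 1) - y" for t
  define \<gamma>' where "\<gamma>' t = 2 *\<^sub>R g' (2 * t) + 2 *\<^sub>R h' (2 * t - 1)" for t
  have "(\<gamma> has_vector_derivative \<gamma>' t) (at t)" for t
  proof -
    have "((\<lambda>t. 2 * t) has_real_derivative 2) (at t)"
      "((\<lambda>t. 2 * t - 1) has_real_derivative 2) (at t)"
      by (auto intro!: derivative_eq_intros)
    note s = this[unfolded has_real_derivative_iff_has_vector_derivative]
    show ?thesis
      using vector_diff_chain_at[OF s(1) g(1)] vector_diff_chain_at[OF s(2) h(1)]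
      unfolding \<gamma>_def \<gamma>'_def o_def
      by (auto intro!: derivative_eq_intros)
  qed
  moreover have "continuous_on UNIV \<gamma>'"
    unfolding \<gamma>'_def
    by (intro continuous_intros continuous_on_compose2[OF g(2)] continuous_on_compose2[OF h(2)]) auto
  moreover have "((\<lambda>t. l (2 * t) + m (2 * t - 1)) has_real_derivative 2 * l' (2 * t) + 2 * m' (2 * t - 1)) (at t)" for t
  proof -
    have "((\<lambda>t. 2 * t) has_real_derivative 2) (at t)"
      "((\<lambda>t. 2 * t - 1) has_real_derivative 2) (at t)"
      by (auto intro!: derivative_eq_intros)
    from DERIV_add[OF DERIV_chain2[OF g(3) this(1)] DERIV_chain2[OF h(3) this(2)]]
    show ?thesis by (simp add: mult.commute)
  qed
  moreover have "norm (\<gamma>' t) \<le> 2 * l' (2 * t) + 2 * m' (2 * t - 1)" for t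
    unfolding \<gamma>'_def by (rule order_trans[OF norm_triangle_ineq])
      (use g(4)[of "2 * t"] h(4)[of "2 * t - 1"] in simp)
  moreover have "\<gamma> t \<in> S" for t
    using g(5) h(5) g(8)[of "2*t"] h(6)[of "2*t-1"] by (cases "t \<le> 1/2") (auto simp: \<gamma>_def)
  ultimately show ?thesis
    unfolding joinable_def
    by (intro exI[of _ \<gamma>] exI[of _ \<gamma>'] exI[of _ "\<lambda>t. l (2 * t) + m (2 * t - 1)"]
          exI[of _ "\<lambda>t. 2 * l' (2 * t) + 2 * m' (2 * t - 1)"])
       (auto simp: \<gamma>_def g h)
qed

text \<open>Velocities keep their norm under \<open>f\<close>, so the majorant \<open>l\<close> can
  be kept. This carries curves of frames back to the Stiefel manifold.\<close>

lemma joinable_isometric_image: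
  assumes "joinable S x y L" and f: "linear f" "\<And>v. norm (f v) = norm v" and "f ` S \<subseteq> T"
  shows "joinable T (f x) (f y) L"
proof -
  obtain g g' l l' where g:
     "\<And>t. (g has_vector_derivative g' t) (at t)" "continuous_on UNIV g'"
     "\<And>t. (l has_real_derivative l' t) (at t)" "\<And>t. norm (g' t) \<le> l' t" "range g \<subseteq> S"
     "\<And>t. t\<le>0 \<Longrightarrow> g t = x" "\<And>t. t\<le>0 \<Longrightarrow> l t = 0" "\<And>t. t\<ge>1 \<Longrightarrow> g t = y" "\<And>t. t\<ge>1 \<Longrightarrow> l t = L"
    using assms(1) by (rule joinableE) blast
  have bl: "bounded_linear f" using f(1) by (simp add: linear_linear)
  have "range (\<lambda>t. f (g t)) \<subseteq> T" using g(5) assms(4) by blast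
  with g f bounded_linear.has_vector_derivative[OF bl g(1)] bounded_linear.continuous_on[OF bl g(2)]
  show ?thesis unfolding joinable_def
    by (intro exI[of _ "\<lambda>t. f (g t)"] exI[of _ "\<lambda>t. f (g' t)"] exI[of _ l] exI[of _ l']) simp
qed

section \<open>Reparametrisation that starts and stops at rest\<close>

definition pos_sq :: "real \<Rightarrow> real" where "pos_sq t = (max 0 t)\<^sup>2"

lemma pos_sq_deriv: "(pos_sq has_real_derivative 2 * max 0 t) (at t)"
proof -
  consider "t < 0" | "t = 0" | "t > 0" by linarith
  then show ?thesis
  proof cases
    case 1
    have "((\<lambda>_. 0) has_real_derivative 2 * max 0 t) (at t)" using 1 by (auto intro!: derivative_eq_intros)
    moreover have "eventually (\<lambda>s. s < 0) (nhds t)" using 1 eventually_nhds_in_open[of "{..<0}" t] by simp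
    then have "eventually (\<lambda>s. 0 = pos_sq s) (nhds t)"
      by eventually_elim (auto simp: pos_sq_def)
    ultimately show ?thesis by (rule DERIV_cong_ev[OF refl _ refl, THEN iffD1, rotated])
  next
    case 3
    have "((\<lambda>t. t\<^sup>2) has_real_derivative 2 * max 0 t) (at t)" using 3 by (auto intro!: derivative_eq_intros)
    moreover have "eventually (\<lambda>s. s > 0) (nhds t)" using 3 eventually_nhds_in_open[of "{0<..}" t] by simp
    then have "eventually (\<lambda>s. s\<^sup>2 = pos_sq s) (nhds t)"
      by eventually_elim (auto simp: pos_sq_def)
    ultimately show ?thesis by (rule DERIV_cong_ev[OF refl _ refl, THEN iffD1, rotated])
  next
    case 2
    have "((\<lambda>h. pos_sq h / h) \<longlongrightarrow> 0) (at 0)"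
    proof (rule Lim_null_comparison[OF always_eventually])
      show "\<forall>h. norm (pos_sq h / h) \<le> \<bar>h\<bar>"
        by (auto simp: pos_sq_def max_def power2_eq_square)
      show "((\<lambda>h::real. \<bar>h\<bar>) \<longlongrightarrow> 0) (at 0)" by (auto intro!: tendsto_eq_intros)
    qed
    with 2 show ?thesis by (simp add: DERIV_def pos_sq_def)
  qed
qed

text \<open>A quadratic spline: \<open>2 * t^2\<close> on the first half of the unit interval,
  \<open>1 - 2 * (1 - t)^2\<close> on the second, and constant outside.\<close>

definition ramp :: "real \<Rightarrow> real" where
  "ramp t = 2 * pos_sq t - 4 * pos_sq (t - 1/2) + 2 * pos_sq (t - 1)"

definition ramp' :: "real \<Rightarrow> real" where
  "ramp' t = 4 * max 0 t - 8 * max 0 (t - 1/2) + 4 * max 0 (t - 1)"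

lemma ramp_deriv: "(ramp has_real_derivative ramp' t) (at t)"
proof -
  have sh: "((\<lambda>t. pos_sq (t - c)) has_real_derivative 2 * max 0 (t - c)) (at t)" for c
  proof -
    have "((\<lambda>t. t - c) has_real_derivative 1) (at t)" by (auto intro!: derivative_eq_intros)
    from DERIV_chain2[OF pos_sq_deriv this] show ?thesis by simp
  qed
  show ?thesis
    using DERIV_add[OF DERIV_diff[OF DERIV_cmult[OF pos_sq_deriv, of 2] DERIV_cmult[OF sh[of "1/2"], of 4]] DERIV_cmult[OF sh[of 1], of 2]]
    unfolding ramp_def[abs_def] ramp'_def by simp
qed

lemma ramp'_nonneg: "ramp' t \<ge> 0"
  by (auto simp: ramp'_def max_def)

lemma ramp_0: "t \<le> 0 \<Longrightarrow> ramp t = 0" and ramp_1: "t \<ge> 1 \<Longrightarrow> ramp t = 1"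
  by (auto simp: ramp_def pos_sq_def max_def power2_eq_square algebra_simps)

lemma ramp_mem: "ramp t \<in> {0..1}"
proof -
  have mono: "ramp a \<le> ramp b" if "a \<le> b" for a b
    by (rule DERIV_nonneg_imp_nondecreasing[OF that]) (use ramp_deriv ramp'_nonneg in auto)
  \<comment> \<open>The points \<open>min 0 t\<close> and \<open>max 1 t\<close> enclose
    \<open>t\<close> and have the known values 0 and 1.\<close>
  show ?thesis
    using mono[of "min 0 t" t] mono[of t "max 1 t"] by (simp add: ramp_0 ramp_1)
qed

text \<open>Composition with \<open>ramp\<close> brings the curve to rest at both ends, so that it
  extends by constants; the arc length is majorised by \<open>L * ramp t\<close>, which grows by
  \<open>L\<close> in total.\<close>

lemma joinable_bounded_speed:
  assumes "\<And>s. s \<in> {0..1} \<Longrightarrow> (g has_vector_derivative g' s) (at s)"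
    and "continuous_on {0..1} g'" and "\<And>s. s \<in> {0..1} \<Longrightarrow> norm (g' s) \<le> L"
    and "g ` {0..1} \<subseteq> S"
  shows "joinable S (g 0) (g 1) L"
proof -
  have "((\<lambda>t. g (ramp t)) has_vector_derivative ramp' t *\<^sub>R g' (ramp t)) (at t)" for t
    using vector_diff_chain_at[OF ramp_deriv[unfolded has_real_derivative_iff_has_vector_derivative] assms(1)[OF ramp_mem]]
    by (simp add: o_def)
  moreover have "continuous_on UNIV ramp" by (intro continuous_at_imp_continuous_on ballI DERIV_isCont[OF ramp_deriv])
  then have "continuous_on UNIV (\<lambda>t. ramp' t *\<^sub>R g' (ramp t))"
    using ramp_mem unfolding ramp'_def
    by (intro continuous_intros continuous_on_compose2[OF assms(2)]) auto
  moreover have "((\<lambda>t. L * ramp t) has_real_derivative L * ramp' t) (at t)" for t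
    by (rule DERIV_cmult[OF ramp_deriv])
  moreover have "norm (ramp' t *\<^sub>R g' (ramp t)) \<le> L * ramp' t" for t
    using assms(3)[OF ramp_mem[of t]] ramp'_nonneg[of t] by (simp add: mult_right_mono mult.commute[of "ramp' t"])
  moreover have "range (\<lambda>t. g (ramp t)) \<subseteq> S" using assms(4) ramp_mem by blast
  ultimately show ?thesis unfolding joinable_def
    by (intro exI[of _ "\<lambda>t. g (ramp t)"] exI[of _ "\<lambda>t. ramp' t *\<^sub>R g' (ramp t)"]
         exI[of _ "\<lambda>t. L * ramp t"] exI[of _ "\<lambda>t. L * ramp' t"])
      (auto simp: ramp_0 ramp_1)
qed

section \<open>From joinability to the geodesic distance\<close>

lemma curve_length_nonneg: "curve_length \<gamma> \<ge> 0"
  unfolding curve_length_def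
  \<comment> \<open>A non-integrable speed has integral 0 by default.\<close>
  by (cases "(\<lambda>t. norm (vector_derivative \<gamma> (at t within {0..1}))) integrable_on {0..1}")
    (auto intro: integral_nonneg simp: not_integrable_integral)

lemma joinable_C1_curve:
  assumes "joinable S x y L"
  obtains \<gamma> where "C1_curve \<gamma>" "\<gamma> ` {0..1} \<subseteq> S" "\<gamma> 0 = x" "\<gamma> 1 = y" "curve_length \<gamma> \<le> L"
proof -
  obtain g g' l l' where g:
     "\<And>t. (g has_vector_derivative g' t) (at t)" "continuous_on UNIV g'"
     "\<And>t. (l has_real_derivative l' t) (at t)" "\<And>t. norm (g' t) \<le> l' t" "range g \<subseteq> S"
     "\<And>t. t\<le>0 \<Longrightarrow> g t = x" "\<And>t. t\<le>0 \<Longrightarrow> l t = 0" "\<And>t. t\<ge>1 \<Longrightarrow> g t = y" "\<And>t. t\<ge>1 \<Longrightarrow> l t = L"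
    using assms by (rule joinableE) blast
  have vd: "vector_derivative g (at t within {0..1}) = g' t" if "t \<in> {0..1}" for t
    using that g(1) by (intro vector_derivative_at_within_ivl) auto
  have c: "continuous_on {0..1} g'" using g(2) continuous_on_subset by blast
  have "C1_curve g" unfolding C1_curve_def
  proof
    show "g differentiable_on {0..1}"
      using g(1) by (meson differentiable_at_imp_differentiable_on differentiableI_vector)
    show "continuous_on {0..1} (\<lambda>t. vector_derivative g (at t within {0..1}))"
      using c by (rule continuous_on_eq) (simp add: vd)
  qed
  moreover have "curve_length g \<le> L"
  proof -
    have "curve_length g = integral {0..1} (\<lambda>t. norm (g' t))"
      unfolding curve_length_def by (rule integral_cong) (simp add: vd)
    \<comment> \<open>The gauge integral integrates every derivative, so \<open>l'\<close> has
      integral \<open>l 1 - l 0\<close>, and it dominates the speed.\<close>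
    also have "\<dots> \<le> l 1 - l 0"
    proof (rule has_integral_le[OF integrable_integral])
      show "(\<lambda>t. norm (g' t)) integrable_on {0..1}"
        using c by (intro integrable_continuous_real continuous_on_norm)
      show "(l' has_integral l 1 - l 0) {0..1}"
        using g(3) by (intro fundamental_theorem_of_calculus)
          (auto simp: has_real_derivative_iff_has_vector_derivative has_vector_derivative_at_within)
    qed (use g(4) in auto)
    finally show ?thesis using g by simp
  qed
  moreover have "g ` {0..1} \<subseteq> S" using g(5) by blast
  ultimately show ?thesis using that[of g] g(6)[of 0] g(8)[of 1] by simp
qed

lemma dist_E_le:
  assumes "joinable stiefel U V L"
  shows "dist_E U V \<le> L"
proof -
  obtain \<gamma> where \<gamma>: "C1_curve \<gamma>" "\<gamma> ` {0..1} \<subseteq> stiefel" "\<gamma> 0 = U" "\<gamma> 1 = V" "curve_length \<gamma> \<le> L"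
    using assms by (rule joinable_C1_curve) blast
  have "dist_E U V \<le> curve_length \<gamma>"
    unfolding dist_E_def
    by (rule cInf_lower) (use \<gamma>(1-4) in blast, auto intro!: bdd_belowI[of _ 0] simp: curve_length_nonneg)
  with \<gamma>(5) show ?thesis by linarith
qed

section \<open>Normalised chords between orthonormal frames\<close>

text \<open>A vector is the finite sum of its components, each embedded by the bounded linear map
  \<open>axis i\<close>.\<close>

lemma has_vector_derivative_vec_lambda:
  fixes f :: "real \<Rightarrow> 'b::finite \<Rightarrow> 'a::real_normed_vector"
  assumes "\<And>i. ((\<lambda>t. f t i) has_vector_derivative f' i) (at t)"
  shows "((\<lambda>t. \<chi> i. f t i) has_vector_derivative (\<chi> i. f' i)) (at t)"
proof -
  have sum_axis: "(\<chi> i. x i) = (\<Sum>i\<in>UNIV. axis i (x i))" for x :: "'b \<Rightarrow> 'a"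
    by (simp add: vec_eq_iff axis_def sum.delta)
  have "bounded_linear (axis i :: 'a \<Rightarrow> 'a^'b)" for i
    by (rule bounded_linear_intro[of _ 1])
      (auto simp: vec_eq_iff axis_def norm_vec_def L2_set_def if_distrib[of norm] if_distrib[of "\<lambda>x. x^2"] sum.delta cong: if_cong)
  from bounded_linear.has_vector_derivative[OF this assms]
  show ?thesis unfolding sum_axis
    by (intro has_vector_derivative_sum) auto
qed

lemma norm_vec_sq: "(norm x)\<^sup>2 = (\<Sum>i\<in>UNIV. (norm (x $ i))\<^sup>2)"
  for x :: "'a::real_normed_vector ^ 'b::finite"
  by (simp add: norm_vec_def L2_set_def sum_nonneg)

text \<open>The velocity of the line \<open>a + t *\<^sub>R b\<close> after projection to the unit
  sphere: the part of \<open>b\<close> orthogonal to the current point, divided by the norm of that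
  point.\<close>

definition sgn_chord_deriv :: "'a::real_inner \<Rightarrow> 'a \<Rightarrow> real \<Rightarrow> 'a" where
  "sgn_chord_deriv a b t = b /\<^sub>R norm (a + t *\<^sub>R b) - (((a + t *\<^sub>R b) \<bullet> b) / norm (a + t *\<^sub>R b) ^ 3) *\<^sub>R (a + t *\<^sub>R b)"

lemma sgn_chord_has_vector_derivative:
  fixes a b :: "'a::real_inner"
  assumes "a + t *\<^sub>R b \<noteq> 0"
  shows "((\<lambda>t. sgn (a + t *\<^sub>R b)) has_vector_derivative sgn_chord_deriv a b t) (at t)"
proof -
  define c where "c = (\<lambda>t. a + t *\<^sub>R b)"
  have nz: "norm (c t) \<noteq> 0" using assms by (simp add: c_def)
  have "((\<lambda>t. a \<bullet> a + 2 * t * (a \<bullet> b) + t\<^sup>2 * (b \<bullet> b)) has_real_derivative 2 * (c t \<bullet> b)) (at t)"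
    by (auto intro!: derivative_eq_intros simp: c_def inner_simps)
  moreover have "c t \<bullet> c t = a \<bullet> a + 2 * t * (a \<bullet> b) + t\<^sup>2 * (b \<bullet> b)" for t
    by (simp add: c_def inner_simps inner_commute power2_eq_square algebra_simps)
  ultimately have N: "((\<lambda>t. c t \<bullet> c t) has_real_derivative 2 * (c t \<bullet> b)) (at t)"
    by simp
  have "c t \<bullet> c t > 0" using nz by simp
  from DERIV_chain2[OF DERIV_real_sqrt[OF this] N] have "((\<lambda>t. norm (c t)) has_real_derivative (c t \<bullet> b) / norm (c t)) (at t)"
    by (simp add: norm_eq_sqrt_inner field_simps)
  then have "((\<lambda>t. inverse (norm (c t))) has_real_derivative - ((c t \<bullet> b) / norm (c t) ^ 3)) (at t)"
    using nz by (auto intro!: derivative_eq_intros simp: field_simps power3_eq_cube power2_eq_square)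
  moreover have "(c has_vector_derivative b) (at t)"
    unfolding c_def by (auto intro!: derivative_eq_intros)
  ultimately have "((\<lambda>t. c t /\<^sub>R norm (c t)) has_vector_derivative
      inverse (norm (c t)) *\<^sub>R b + - ((c t \<bullet> b) / norm (c t) ^ 3) *\<^sub>R c t) (at t)"
    by (rule has_vector_derivative_scaleR)
  then show ?thesis by (simp add: sgn_div_norm sgn_chord_deriv_def c_def)
qed

text \<open>Dropping the radial part of \<open>b\<close> cannot lengthen it: the squared norm is the
  square of the bound minus a square coming from the radial part.\<close>

lemma norm_sgn_chord_deriv:
  fixes a b :: "'a::real_inner"
  assumes "a + t *\<^sub>R b \<noteq> 0"
  shows "norm (sgn_chord_deriv a b t) \<le> norm b / norm (a + t *\<^sub>R b)"
proof (rule power2_le_imp_le)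
  define c where "c = a + t *\<^sub>R b"
  have nz: "norm c > 0" using assms by (simp add: c_def)
  have cc: "c \<bullet> c = norm c * norm c" by (simp add: dot_square_norm power2_eq_square)
  have "(norm (sgn_chord_deriv a b t))\<^sup>2 = (b \<bullet> b) / (norm c)\<^sup>2 - 2 * (c \<bullet> b)\<^sup>2 / (norm c) ^ 4 + (c \<bullet> b)\<^sup>2 / (norm c) ^ 6 * (norm c)\<^sup>2"
    unfolding sgn_chord_deriv_def c_def[symmetric] power2_norm_eq_inner using nz
    by (simp add: inner_simps inner_commute field_simps power_numeral_reduce cc)
  also have "\<dots> = (norm b / norm c)\<^sup>2 - ((c \<bullet> b) / (norm c)\<^sup>2)\<^sup>2"
    using nz by (simp add: power_divide field_simps power_numeral_reduce cc dot_square_norm[of b])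
  finally show "(norm (sgn_chord_deriv a b t))\<^sup>2 \<le> (norm b / norm (a + t *\<^sub>R b))\<^sup>2"
    by (simp add: c_def)
qed simp

text \<open>The Stiefel manifold with its matrices transposed: a column becomes the component
  \<open>W $ i\<close>, which can be treated as one vector.\<close>

definition frames :: "(real ^ 'n ^ 'p) set" where
  "frames = {W. \<forall>i j. W $ i \<bullet> W $ j = (if i = j then 1 else 0)}"

lemma frames_norm: "W \<in> frames \<Longrightarrow> norm (W $ i) = 1"
  by (simp add: frames_def norm_eq_1)

lemma norm_chord_sq:
  fixes u v :: "'a::real_inner"
  assumes "norm u = 1" "norm v = 1"
  shows "(norm (u + t *\<^sub>R (v - u)))\<^sup>2 = 1 - t * (1 - t) * (norm (u - v))\<^sup>2"
  using assms unfolding norm_eq_1 power2_norm_eq_inner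
  by (simp add: inner_simps inner_commute algebra_simps)

text \<open>The product expands with weights \<open>(1 - t)^2\<close>, \<open>t * (1 - t)\<close>
  and \<open>t^2\<close> on \<open>u \<bullet> x\<close>,
  \<open>u \<bullet> y + v \<bullet> x\<close> and \<open>v \<bullet> y\<close>, and all three
  vanish.\<close>

lemma chord_orthogonal:
  fixes u v x y :: "'a::real_inner"
  assumes "u \<bullet> x = 0" "v \<bullet> y = 0" "u \<bullet> y + v \<bullet> x = 0"
  shows "(u + t *\<^sub>R (v - u)) \<bullet> (x + t *\<^sub>R (y - x)) = 0"
proof -
  have "v \<bullet> x = - (u \<bullet> y)" using assms(3) by simp
  with assms(1,2) show ?thesis by (simp add: inner_simps algebra_simps)
qed

text \<open>Each column follows its normalised chord; \<open>cross\<close> keeps different columns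
  orthogonal. The chords stay at distance at least \<open>cos \<alpha>\<close> from 0, so
  normalising raises the speed from at most \<open>2 * sin \<alpha>\<close> to at most
  \<open>2 * tan \<alpha>\<close>.\<close>

lemma frames_joinable:
  fixes U V :: "real ^ 'n ^ 'p"
  assumes U: "U \<in> frames" and V: "V \<in> frames"
    and cross: "\<And>i j. i \<noteq> j \<Longrightarrow> U $ i \<bullet> V $ j + V $ i \<bullet> U $ j = 0"
    and \<alpha>: "0 \<le> \<alpha>" "\<alpha> < pi / 2" and close: "norm (U - V) \<le> 2 * sin \<alpha>"
  shows "joinable frames U V (2 * tan \<alpha>)"
proof -
  define c where "c t i = U $ i + t *\<^sub>R (V $ i - U $ i)" for t i
  have cos: "cos \<alpha> > 0" using \<alpha> by (intro cos_gt_zero_pi) auto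
  have c_ge: "norm (c t i) \<ge> cos \<alpha>" if "t \<in> {0..1}" for t i
  proof (rule power2_le_imp_le)
    have "norm (U $ i - V $ i) \<le> 2 * sin \<alpha>"
      using Finite_Cartesian_Product.norm_nth_le[of "U - V" i] close by simp
    then have "(norm (U $ i - V $ i))\<^sup>2 \<le> (2 * sin \<alpha>)\<^sup>2" by (intro power_mono) auto
    \<comment> \<open>A chord is closest to 0 at its middle; there its squared norm is still at
      least \<open>1 - (sin \<alpha>)^2\<close>.\<close>
    moreover have "t * (1 - t) \<le> 1 / 4"
      using zero_le_power2[of "t - 1/2"] by (simp add: power2_eq_square algebra_simps)
    ultimately have "t * (1 - t) * (norm (U $ i - V $ i))\<^sup>2 \<le> 1 / 4 * (2 * sin \<alpha>)\<^sup>2"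
      by (intro mult_mono) auto
    also have "\<dots> = 1 - (cos \<alpha>)\<^sup>2" by (simp add: power_mult_distrib sin_squared_eq)
    finally show "(cos \<alpha>)\<^sup>2 \<le> (norm (c t i))\<^sup>2"
      unfolding c_def using norm_chord_sq[OF frames_norm[OF U] frames_norm[OF V]] by simp
  qed simp
  have nz: "c t i \<noteq> 0" if "t \<in> {0..1}" for t i
    using c_ge[OF that, of i] cos by auto
  define g where "g t = (\<chi> i. sgn (c t i))" for t
  define g' where "g' t = (\<chi> i. sgn_chord_deriv (U $ i) (V $ i - U $ i) t)" for t
  have "joinable frames (g 0) (g 1) (2 * tan \<alpha>)"
  proof (rule joinable_bounded_speed)
    fix t :: real assume t: "t \<in> {0..1}"
    show "(g has_vector_derivative g' t) (at t)"
      unfolding g_def g'_def c_def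
      by (intro has_vector_derivative_vec_lambda sgn_chord_has_vector_derivative nz[OF t, unfolded c_def])
    show "norm (g' t) \<le> 2 * tan \<alpha>"
    proof -
      have "norm (g' t $ i) \<le> norm ((V - U) $ i) / cos \<alpha>" for i
      proof -
        have "norm (g' t $ i) \<le> norm (V $ i - U $ i) / norm (c t i)"
          unfolding g'_def c_def using norm_sgn_chord_deriv[OF nz[OF t, unfolded c_def]] by simp
        also have "\<dots> \<le> norm (V $ i - U $ i) / cos \<alpha>"
          using cos c_ge[OF t] nz[OF t] by (intro divide_left_mono mult_pos_pos) auto
        finally show ?thesis by simp
      qed
      \<comment> \<open>All columns share the factor \<open>1 / cos \<alpha>\<close>, so the
        columnwise bounds combine to a bound for the Frobenius norm.\<close>
      then have "norm (g' t) \<le> norm ((V - U) /\<^sub>R cos \<alpha>)"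
        using cos unfolding norm_vec_def[of "g' t"] norm_vec_def[of "(V - U) /\<^sub>R cos \<alpha>"]
        by (intro L2_set_mono) (auto simp: divide_inverse mult.commute)
      also have "\<dots> = norm (U - V) / cos \<alpha>"
        using cos by (simp add: norm_minus_commute divide_inverse mult.commute)
      also have "\<dots> \<le> 2 * tan \<alpha>"
        unfolding tan_def using cos close by (simp add: divide_right_mono)
      finally show ?thesis .
    qed
  next
    show "continuous_on {0..1} g'"
      unfolding g'_def sgn_chord_deriv_def
      by (intro continuous_intros) (use nz in \<open>auto simp: c_def\<close>)
    have "sgn (c t i) \<bullet> sgn (c t j) = (if i = j then 1 else 0)" if "t \<in> {0..1}" for t i j
    proof (cases "i = j")
      case True
      then show ?thesis using nz[OF that] by (simp add: norm_sgn dot_square_norm)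
    next
      case False
      then have "c t i \<bullet> c t j = 0"
        unfolding c_def using U V cross by (intro chord_orthogonal) (auto simp: frames_def)
      with False show ?thesis by (simp add: sgn_div_norm)
    qed
    then show "g ` {0..1} \<subseteq> frames" by (auto simp: frames_def g_def)
  qed
  moreover have "g 0 = U" "g 1 = V"
    by (simp_all add: g_def c_def vec_eq_iff sgn_div_norm frames_norm[OF U] frames_norm[OF V])
  ultimately show ?thesis by simp
qed

text \<open>The columns span at most \<open>CARD('p)\<close> dimensions. The spare direction
  replaces the midpoint of an antipodal pair of columns, and it provides the plane of rotation for
  the extremal pairs.\<close>

lemma frames_orthogonal_unit:
  fixes U :: "real ^ 'n ^ 'p"
  assumes "CARD('p) < CARD('n)"
  obtains w where "norm w = 1" "\<And>i. w \<bullet> U $ i = 0"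
proof -
  have "dim (range (\<lambda>i. U $ i)) < DIM(real^'n)"
    using dim_le_card'[of "range (\<lambda>i. U $ i)"] card_image_le[of UNIV "\<lambda>i. U $ i"] assms by simp
  then obtain z where z: "z \<noteq> 0" "\<And>y. y \<in> span (range (\<lambda>i. U $ i)) \<Longrightarrow> orthogonal z y"
    by (rule orthogonal_to_subspace_exists) blast
  have "norm (sgn z) = 1" "\<And>i. sgn z \<bullet> U $ i = 0"
    using z by (auto simp: norm_sgn sgn_div_norm orthogonal_def span_base)
  then show ?thesis using that by blast
qed

text \<open>Corresponding columns are replaced by their midpoint on the sphere, the normalised sum;
  \<open>cross\<close> makes these midpoints orthogonal. The squared distances of the columns are
  then bounded linearly in \<open>x i\<close> and summed.\<close>

lemma frames_midpoint:
  fixes U V :: "real ^ 'n ^ 'p"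
  assumes card: "CARD('p) < CARD('n)" and U: "U \<in> frames" and V: "V \<in> frames"
    and cross: "\<And>i j. i \<noteq> j \<Longrightarrow> U $ i \<bullet> V $ j + V $ i \<bullet> U $ j = 0"
    and \<alpha>: "0 \<le> \<alpha>" "\<alpha> \<le> pi / 2" and close: "norm (U - V) \<le> 2 * sin \<alpha>"
  shows "\<exists>M\<in>frames. norm (U - M) \<le> 2 * sin (\<alpha> / 2) \<and> norm (M - V) \<le> 2 * sin (\<alpha> / 2)"
proof -
  \<comment> \<open>This is the squared sine of half the angle between the two columns.\<close>
  define x where "x i = (norm (U $ i - V $ i))\<^sup>2 / 4" for i
  have cos: "cos \<alpha> \<ge> 0" using \<alpha> by (intro cos_ge_zero) auto
  have x0: "x i \<ge> 0" for i by (simp add: x_def)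
  have xsum: "(\<Sum>i\<in>UNIV. x i) \<le> (sin \<alpha>)\<^sup>2"
  proof -
    have "(\<Sum>i\<in>UNIV. x i) = (norm (U - V))\<^sup>2 / 4"
      by (simp add: norm_vec_sq x_def sum_divide_distrib)
    also have "\<dots> \<le> (2 * sin \<alpha>)\<^sup>2 / 4" by (intro divide_right_mono power_mono close) auto
    finally show ?thesis by (simp add: power_mult_distrib)
  qed
  have x_dot: "x i = (1 - U $ i \<bullet> V $ i) / 2" for i
    using frames_norm[OF U, of i] frames_norm[OF V, of i] unfolding norm_eq_1 x_def power2_norm_eq_inner
    by (simp add: inner_simps inner_commute)
  have UV: "(norm (U $ i + V $ i))\<^sup>2 = 4 * (1 - x i)" for i
    using frames_norm[OF U, of i] frames_norm[OF V, of i] unfolding norm_eq_1 power2_norm_eq_inner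
    by (simp add: inner_simps inner_commute x_dot field_simps)
  have UUV: "U $ i \<bullet> (U $ i + V $ i) = 2 * (1 - x i)" "V $ i \<bullet> (U $ i + V $ i) = 2 * (1 - x i)" for i
    using frames_norm[OF U, of i] frames_norm[OF V, of i] unfolding norm_eq_1
    by (simp_all add: inner_simps inner_commute x_dot field_simps)
  obtain w where w: "norm w = 1" "\<And>i. w \<bullet> U $ i = 0" "\<And>i. U $ i \<bullet> w = 0"
    using frames_orthogonal_unit[OF card, of U] by (metis inner_commute)
  have others: "V $ j = U $ j" if "U $ i + V $ i = 0" "j \<noteq> i" for i j
  proof -
    have "x i + x j = sum x {i, j}" using that(2) by simp
    also have "\<dots> \<le> sum x UNIV" by (intro sum_mono2) (auto simp: x0)
    also have "\<dots> \<le> 1" using xsum abs_square_le_1[of "sin \<alpha>"] by simp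
    finally have "x j \<le> 0" using UV[of i] that(1) by simp
    then show ?thesis by (simp add: x_def)
  qed
  \<comment> \<open>If \<open>U $ i = - V $ i\<close>, this pair of columns exhausts the chordal distance 2; any unit vector
    orthogonal to the frame then serves as the midpoint of the pair.\<close>
  define M where "M = (\<chi> i. if U $ i + V $ i = 0 then w else sgn (U $ i + V $ i))"
  \<comment> \<open>Two nonzero sums are orthogonal by \<open>cross\<close>. If one sum is zero, the
    other is twice a column of \<open>U\<close>, hence nonzero and orthogonal to \<open>w\<close>;
    so two zero sums cannot occur.\<close>
  have M_dot: "M $ i \<bullet> M $ j = 0" if "i \<noteq> j" for i j
  proof -
    have d: "(U $ i + V $ i) \<bullet> (U $ j + V $ j) = 0"
      using U V cross[OF that] that by (simp add: frames_def inner_simps)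
    have nn: "U $ j + V $ j \<noteq> 0" if "U $ i + V $ i = 0" "j \<noteq> i" for i j
      using others[OF that] frames_norm[OF U, of j] by (auto simp flip: scaleR_2)
    have "w \<bullet> (U $ j + V $ j) = 0" if "U $ i + V $ i = 0" "j \<noteq> i" for i j
      by (simp only: others[OF that] inner_add_right w(2) add_0)
    then show ?thesis using that d nn[of i j] nn[of j i]
      by (auto simp: M_def sgn_div_norm inner_commute)
  qed
  have M1: "norm (M $ i) = 1" for i by (simp add: M_def w norm_sgn)
  have "M \<in> frames" using M_dot M1 by (simp add: frames_def norm_eq_1)
  \<comment> \<open>This is the cosine of half the angle between the columns; for an antipodal pair
    both sides are 0.\<close>
  have s: "U $ i \<bullet> M $ i = sqrt (1 - x i) \<and> V $ i \<bullet> M $ i = sqrt (1 - x i)" for i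
  proof (cases "U $ i + V $ i = 0")
    case True
    then have "V $ i = - U $ i" by (simp add: add_eq_0_iff)
    with True UV[of i] w show ?thesis by (simp add: M_def)
  next
    case False
    have "norm (U $ i + V $ i) = 2 * sqrt (1 - x i)"
      using UV[of i] by (metis norm_ge_zero real_sqrt_four real_sqrt_mult real_sqrt_unique)
    moreover have "sqrt (1 - x i) * (2 * sqrt (1 - x i)) = 2 * (1 - x i)"
    proof -
      have "1 - x i \<ge> 0" using UV[of i] zero_le_power2[of "norm (U $ i + V $ i)"] by simp
      then have "sqrt (1 - x i) * sqrt (1 - x i) = 1 - x i" by simp
      then show ?thesis by (metis mult.left_commute)
    qed
    moreover have "Z \<bullet> M $ i = (Z \<bullet> (U $ i + V $ i)) / norm (U $ i + V $ i)" for Z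
      using False by (simp add: M_def sgn_div_norm divide_inverse mult.commute del: inner_add_right scaleR_add_right)
    moreover have "norm (U $ i + V $ i) \<noteq> 0" using False by simp
    ultimately show ?thesis by (simp add: divide_eq_eq UUV del: inner_add_right)
  qed
  have bound: "norm (Z - M) \<le> 2 * sin (\<alpha> / 2)"
    if Z: "\<And>i. norm (Z $ i) = 1" "\<And>i. Z $ i \<bullet> M $ i = sqrt (1 - x i)" for Z :: "real ^ 'n ^ 'p"
  proof (rule power2_le_imp_le)
    \<comment> \<open>With \<open>s = sqrt (1 - x i)\<close> one has
      \<open>1 - s = x i / (1 + s)\<close>, and \<open>s\<close> is at least
      \<open>cos \<alpha>\<close>. The resulting bound is linear in \<open>x i\<close>, so
      \<open>xsum\<close> controls its sum.\<close>
    have "(norm (Z $ i - M $ i))\<^sup>2 \<le> 2 * (x i / (1 + cos \<alpha>))" for i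
    proof -
      have "x i \<le> (sin \<alpha>)\<^sup>2" using xsum member_le_sum[of i UNIV x] x0 by fastforce
      then have *: "(cos \<alpha>)\<^sup>2 \<le> 1 - x i" by (simp add: sin_squared_eq)
      then have "cos \<alpha> \<le> sqrt (1 - x i)" using real_le_rsqrt by blast
      then have "(1 - sqrt (1 - x i)) * (1 + cos \<alpha>) \<le> (1 - sqrt (1 - x i)) * (1 + sqrt (1 - x i))"
        using x0[of i] by (intro mult_left_mono) auto
      also have "\<dots> = x i" using * order_trans[OF zero_le_power2 *]
        by (simp add: algebra_simps)
      finally have "1 - sqrt (1 - x i) \<le> x i / (1 + cos \<alpha>)" using cos by (simp add: field_simps)
      moreover have "(norm (Z $ i - M $ i))\<^sup>2 = 2 - 2 * sqrt (1 - x i)"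
        using Z(1)[of i] M1[of i] Z(2)[of i] unfolding norm_eq_1 power2_norm_eq_inner
        by (simp add: inner_simps inner_commute)
      ultimately show ?thesis by simp
    qed
    then have "(norm (Z - M))\<^sup>2 \<le> (\<Sum>i\<in>UNIV. 2 * (x i / (1 + cos \<alpha>)))"
      unfolding norm_vec_sq by (intro sum_mono) simp
    also have "\<dots> = 2 * sum x UNIV / (1 + cos \<alpha>)"
      by (simp add: sum_distrib_left sum_divide_distrib)
    also have "\<dots> \<le> 2 * (sin \<alpha>)\<^sup>2 / (1 + cos \<alpha>)"
      using xsum cos by (intro divide_right_mono) auto
    also have "\<dots> = 2 * (1 - cos \<alpha>)"
    proof -
      have "(sin \<alpha>)\<^sup>2 = (1 - cos \<alpha>) * (1 + cos \<alpha>)"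
        unfolding sin_squared_eq by (simp add: power2_eq_square algebra_simps)
      with cos show ?thesis by simp
    qed
    also have "\<dots> = (2 * sin (\<alpha> / 2))\<^sup>2"
      using cos_double_sin[of "\<alpha> / 2"] by (simp add: power_mult_distrib)
    finally show "(norm (Z - M))\<^sup>2 \<le> (2 * sin (\<alpha> / 2))\<^sup>2" .
    show "0 \<le> 2 * sin (\<alpha> / 2)" using \<alpha> by (intro mult_nonneg_nonneg sin_ge_zero) auto
  qed
  show ?thesis using \<open>M \<in> frames\<close> bound[of U] bound[of V] s frames_norm[OF U] frames_norm[OF V]
    by (auto simp: norm_minus_commute intro!: bexI[of _ M])
qed

section \<open>Upper bound for the distance\<close>

lemma stiefel_iff_frames: "U \<in> stiefel \<longleftrightarrow> transpose U \<in> frames"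
  by (simp add: stiefel_def frames_def vec_eq_iff matrix_matrix_mult_def transpose_def mat_def inner_vec_def)

lemma norm_transpose: "norm (transpose A) = norm A"
  for A :: "real ^ 'p ^ 'n"
  unfolding norm_eq_frobenius transpose_def by (simp add: sum.swap[of _ "UNIV :: 'p set"])

text \<open>Right multiplication by \<open>Q\<close> applies the orthogonal map
  \<open>transpose Q\<close> to each row.\<close>

lemma norm_matrix_mult_orthogonal:
  fixes A :: "real ^ 'p ^ 'n" and Q :: "real ^ 'p ^ 'p"
  assumes "orthogonal_matrix Q"
  shows "norm (A ** Q) = norm A"
proof -
  have "norm ((A ** Q) $ i) = norm (A $ i)" for i
  proof -
    have "(A ** Q) $ i = transpose Q *v (A $ i)"
      by (simp add: vec_eq_iff matrix_matrix_mult_def vector_matrix_mult_def mult.commute)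
    moreover have "orthogonal_transformation ((*v) (transpose Q))"
      using assms by (simp add: orthogonal_transformation_matrix matrix_vector_mul_linear)
    ultimately show ?thesis by (metis orthogonal_transformation_norm)
  qed
  then show ?thesis by (simp add: norm_vec_def)
qed

lemma stiefel_mult_orthogonal:
  assumes "U \<in> stiefel" "orthogonal_matrix Q"
  shows "U ** Q \<in> stiefel"
proof -
  have "transpose (U ** Q) ** (U ** Q) = transpose Q ** (transpose U ** U) ** Q"
    by (simp add: matrix_transpose_mul matrix_mul_assoc)
  then show ?thesis using assms by (simp add: stiefel_def orthogonal_matrix_def)
qed

text \<open>The cross term is the bilinear form of the symmetric matrix \<open>S\<close>, evaluated
  at two columns of \<open>Q\<close>; it vanishes off the diagonal when these columns are
  orthonormal eigenvectors of \<open>S\<close>.\<close>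

lemma orthogonal_diagonalisation_of_cross_terms:
  fixes U V :: "real ^ 'p ^ 'n"
  obtains Q :: "real ^ 'p ^ 'p" where "orthogonal_matrix Q"
    "\<And>i j. i \<noteq> j \<Longrightarrow> transpose (U ** Q) $ i \<bullet> transpose (V ** Q) $ j + transpose (V ** Q) $ i \<bullet> transpose (U ** Q) $ j = 0"
proof -
  define S where "S = transpose U ** V + transpose V ** U"
  have S_dot: "x \<bullet> (S *v y) = (U *v x) \<bullet> (V *v y) + (V *v x) \<bullet> (U *v y)" for x y
    by (simp add: S_def matrix_vector_mult_add_rdistrib inner_add_right dot_lmul_matrix
         flip: matrix_vector_mul_assoc transpose_matrix_vector)
      (metis dot_lmul_matrix transpose_matrix_vector transpose_transpose)
  have "linear ((*v) S)" by (rule matrix_vector_mul_linear)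
  moreover have "(S *v x) \<bullet> y = x \<bullet> (S *v y)" for x y
    unfolding inner_commute[of "S *v x"] S_dot by (simp add: inner_commute)
  ultimately obtain q :: "'p \<Rightarrow> real^'p" and c where q: "\<And>i j. q i \<bullet> q j = (if i = j then 1 else 0)"
      and eig: "\<And>i. S *v q i = c i *\<^sub>R q i"
    by (rule self_adjoint_orthonormal_eigenbasis) blast
  \<comment> \<open>The lambda lists rows, so the transpose puts the eigenvectors into the
    columns.\<close>
  define Q where "Q = transpose (\<chi> i. q i)"
  have "transpose Q ** Q = mat 1"
    using q by (simp add: Q_def vec_eq_iff matrix_matrix_mult_def transpose_def mat_def inner_vec_def)
  then have "orthogonal_matrix Q" by (simp add: orthogonal_matrix)
  moreover have nth: "transpose (W ** Q) $ i = W *v q i" for W :: "real ^ 'p ^ 'n" and i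
    by (simp add: Q_def vec_eq_iff matrix_matrix_mult_def transpose_def matrix_vector_mult_def)
  have "transpose (U ** Q) $ i \<bullet> transpose (V ** Q) $ j + transpose (V ** Q) $ i \<bullet> transpose (U ** Q) $ j = 0"
    if "i \<noteq> j" for i j
    using q that unfolding nth by (simp flip: S_dot add: eig)
  ultimately show ?thesis by (rule that)
qed

text \<open>For fixed \<open>Q\<close>, the map \<open>f\<close> inverts the change of coordinates
  from \<open>U\<close> to \<open>transpose (U ** Q)\<close>; these are the properties that carry
  curves and midpoints back.\<close>

lemma frames_chart:
  fixes Q :: "real ^ 'p ^ 'p"
  assumes Q: "orthogonal_matrix Q"
  defines "f \<equiv> \<lambda>W :: real ^ 'n ^ 'p. transpose W ** transpose Q"
  shows "linear f" "norm (f W) = norm W" "f ` frames \<subseteq> stiefel" "f (transpose (U ** Q)) = U"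
    "U \<in> stiefel \<Longrightarrow> transpose (U ** Q) \<in> frames"
proof -
  have Q': "orthogonal_matrix (transpose Q)" using Q by simp
  show "linear f"
    by (rule linearI)
      (simp_all add: f_def vec_eq_iff matrix_matrix_mult_def transpose_def sum.distrib sum_distrib_left algebra_simps)
  show "norm (f W) = norm W"
    unfolding f_def norm_matrix_mult_orthogonal[OF Q'] by (rule norm_transpose)
  show "f ` frames \<subseteq> stiefel"
    using Q' by (auto simp: f_def stiefel_iff_frames[of "transpose _"] intro!: stiefel_mult_orthogonal)
  show "f (transpose (U ** Q)) = U"
    using Q by (simp add: f_def orthogonal_matrix_def flip: matrix_mul_assoc)
  show "transpose (U ** Q) \<in> frames" if "U \<in> stiefel"
    using stiefel_mult_orthogonal[OF that Q] by (simp flip: stiefel_iff_frames)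
qed

lemma norm_transpose_mult_diff:
  fixes U V :: "real ^ 'p ^ 'n"
  assumes "orthogonal_matrix Q"
  shows "norm (transpose (U ** Q) - transpose (V ** Q)) = norm (U - V)"
proof -
  have "transpose (U ** Q) - transpose (V ** Q) = transpose ((U - V) ** Q)"
    by (simp add: vec_eq_iff transpose_def matrix_matrix_mult_def sum_subtractf left_diff_distrib)
  then show ?thesis by (simp add: norm_transpose norm_matrix_mult_orthogonal[OF assms])
qed

text \<open>In the columns that diagonalise the cross terms, \<open>frames_joinable\<close> applies;
  the isometry \<open>f\<close> returns the curve.\<close>

lemma stiefel_joinable:
  fixes U V :: "real ^ 'p ^ 'n"
  assumes U: "U \<in> stiefel" and V: "V \<in> stiefel"
    and \<alpha>: "0 \<le> \<alpha>" "\<alpha> < pi / 2" and close: "norm (U - V) \<le> 2 * sin \<alpha>"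
  shows "joinable stiefel U V (2 * tan \<alpha>)"
proof -
  obtain Q where Q: "orthogonal_matrix Q" and cross: "\<And>i j. i \<noteq> j \<Longrightarrow>
      transpose (U ** Q) $ i \<bullet> transpose (V ** Q) $ j + transpose (V ** Q) $ i \<bullet> transpose (U ** Q) $ j = 0"
    by (rule orthogonal_diagonalisation_of_cross_terms[of U V]) blast
  note f = frames_chart[OF Q]
  have "joinable frames (transpose (U ** Q)) (transpose (V ** Q)) (2 * tan \<alpha>)"
    using f(5)[OF U] f(5)[OF V] cross \<alpha> close unfolding norm_transpose_mult_diff[OF Q, symmetric]
    by (rule frames_joinable)
  from joinable_isometric_image[OF this f(1,2,3)] show ?thesis by (simp only: f(4))
qed

lemma stiefel_midpoint:
  fixes U V :: "real ^ 'p ^ 'n"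
  assumes card: "CARD('p) < CARD('n)" and U: "U \<in> stiefel" and V: "V \<in> stiefel"
    and \<alpha>: "0 \<le> \<alpha>" "\<alpha> \<le> pi / 2" and close: "norm (U - V) \<le> 2 * sin \<alpha>"
  obtains M where "M \<in> stiefel" "norm (U - M) \<le> 2 * sin (\<alpha> / 2)" "norm (M - V) \<le> 2 * sin (\<alpha> / 2)"
proof -
  obtain Q where Q: "orthogonal_matrix Q" and cross: "\<And>i j. i \<noteq> j \<Longrightarrow>
      transpose (U ** Q) $ i \<bullet> transpose (V ** Q) $ j + transpose (V ** Q) $ i \<bullet> transpose (U ** Q) $ j = 0"
    by (rule orthogonal_diagonalisation_of_cross_terms[of U V]) blast
  note f = frames_chart[OF Q]
  have "\<exists>N\<in>frames. norm (transpose (U ** Q) - N) \<le> 2 * sin (\<alpha> / 2) \<and> norm (N - transpose (V ** Q)) \<le> 2 * sin (\<alpha> / 2)"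
    using card f(5)[OF U] f(5)[OF V] cross \<alpha> close unfolding norm_transpose_mult_diff[OF Q, symmetric]
    by (rule frames_midpoint)
  then obtain N where N: "N \<in> frames" "norm (transpose (U ** Q) - N) \<le> 2 * sin (\<alpha> / 2)"
      "norm (N - transpose (V ** Q)) \<le> 2 * sin (\<alpha> / 2)"
    by blast
  \<comment> \<open>This exhibits \<open>N\<close> as the coordinates of
    \<open>transpose N ** transpose Q\<close>, so distances to \<open>N\<close> become distances on
    the Stiefel manifold.\<close>
  have "N = transpose ((transpose N ** transpose Q) ** Q)"
    using Q by (simp add: orthogonal_matrix_def flip: matrix_mul_assoc)
  with N norm_transpose_mult_diff[OF Q] have "norm (U - transpose N ** transpose Q) \<le> 2 * sin (\<alpha> / 2)"
      "norm (transpose N ** transpose Q - V) \<le> 2 * sin (\<alpha> / 2)"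
    by metis+
  with that f(3) N(1) show ?thesis by blast
qed

text \<open>Induction on the number of bisections. At least one is made, whence
  \<open>Suc k\<close>: \<open>\<alpha>\<close> may equal \<open>pi / 2\<close>, and a single chord
  is available only below that angle.\<close>

lemma stiefel_joinable_subdivided:
  fixes U V :: "real ^ 'p ^ 'n"
  assumes card: "CARD('p) < CARD('n)" and "U \<in> stiefel" "V \<in> stiefel"
    and "0 \<le> \<alpha>" "\<alpha> \<le> pi / 2" and "norm (U - V) \<le> 2 * sin \<alpha>"
  shows "joinable stiefel U V (2 ^ Suc k * (2 * tan (\<alpha> / 2 ^ Suc k)))"
  using assms(2-)
proof (induction k arbitrary: U V \<alpha>)
  case 0
  obtain M where M: "M \<in> stiefel" "norm (U - M) \<le> 2 * sin (\<alpha> / 2)" "norm (M - V) \<le> 2 * sin (\<alpha> / 2)"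
    using stiefel_midpoint[OF card 0] by blast
  have "0 \<le> \<alpha> / 2" "\<alpha> / 2 < pi / 2" using 0(3,4) pi_gt_zero by linarith+
  from joinable_trans[OF stiefel_joinable[OF 0(1) M(1) this M(2)] stiefel_joinable[OF M(1) 0(2) this M(3)]]
  show ?case by simp
next
  case (Suc k)
  obtain M where M: "M \<in> stiefel" "norm (U - M) \<le> 2 * sin (\<alpha> / 2)" "norm (M - V) \<le> 2 * sin (\<alpha> / 2)"
    using stiefel_midpoint[OF card Suc.prems] by blast
  have "0 \<le> \<alpha> / 2" "\<alpha> / 2 \<le> pi / 2" using Suc.prems pi_gt_zero by auto
  from joinable_trans[OF Suc.IH[OF Suc.prems(1) M(1) this M(2)] Suc.IH[OF M(1) Suc.prems(2) this M(3)]]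
  show ?case by (simp add: mult.commute mult.left_commute)
qed

lemma half_chord_angle:
  assumes "0 \<le> d" "d \<le> 2"
  shows "0 \<le> arcsin (d / 2)" "arcsin (d / 2) \<le> pi / 2" "2 * sin (arcsin (d / 2)) = d"
proof -
  show "0 \<le> arcsin (d / 2)" by (rule arcsin_nonneg) (use assms in simp)
  show "arcsin (d / 2) \<le> pi / 2" by (rule arcsin_ubound) (use assms in simp_all)
  have "sin (arcsin (d / 2)) = d / 2" by (rule sin_arcsin) (use assms in simp_all)
  then show "2 * sin (arcsin (d / 2)) = d" by simp
qed

lemma dist_E_upper_bound:
  fixes U V :: "real ^ 'p ^ 'n"
  assumes card: "CARD('p) < CARD('n)" and "U \<in> stiefel" "V \<in> stiefel" and "norm (U - V) \<le> 2"
  shows "dist_E U V \<le> 2 * arcsin (norm (U - V) / 2)"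
proof -
  define \<alpha> where "\<alpha> = arcsin (norm (U - V) / 2)"
  have \<alpha>: "0 \<le> \<alpha>" "\<alpha> \<le> pi / 2" "norm (U - V) \<le> 2 * sin \<alpha>"
    unfolding \<alpha>_def using half_chord_angle[OF norm_ge_zero assms(4)] by simp_all
  have lim: "(\<lambda>k. 2 ^ Suc k * (2 * tan (\<alpha> / 2 ^ Suc k))) \<longlonglongrightarrow> 2 * \<alpha>"
  proof (cases "\<alpha> = 0")
    case False
    \<comment> \<open>This is the derivative of \<open>tan\<close> at 0. The limit is over nonzero
      arguments, hence the separate case \<open>\<alpha> = 0\<close>.\<close>
    have "((\<lambda>x. tan x / x) \<longlongrightarrow> 1) (at (0::real))"
      using DERIV_tan[of "0::real"] by (simp add: DERIV_def)
    moreover have "filterlim (\<lambda>k. \<alpha> / 2 ^ Suc k) (at 0) sequentially"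
    proof -
      have "(\<lambda>k. \<alpha> * (1 / 2) ^ Suc k) \<longlonglongrightarrow> \<alpha> * 0"
        by (intro tendsto_mult tendsto_const LIMSEQ_Suc LIMSEQ_realpow_zero) auto
      moreover have "\<alpha> * (1 / 2) ^ Suc k = \<alpha> / 2 ^ Suc k" for k
        by (simp only: power_one_over) simp
      ultimately have "(\<lambda>k. \<alpha> / 2 ^ Suc k) \<longlonglongrightarrow> 0" by (simp only: mult_zero_right)
      with False show ?thesis by (simp add: filterlim_at)
    qed
    ultimately have "(\<lambda>k. tan (\<alpha> / 2 ^ Suc k) / (\<alpha> / 2 ^ Suc k)) \<longlonglongrightarrow> 1"
      by (rule filterlim_compose)
    then have "(\<lambda>k. 2 * \<alpha> * (tan (\<alpha> / 2 ^ Suc k) / (\<alpha> / 2 ^ Suc k))) \<longlonglongrightarrow> 2 * \<alpha> * 1"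
      by (intro tendsto_mult tendsto_const)
    with False show ?thesis by (simp add: mult_ac)
  qed simp
  \<comment> \<open>The distance does not depend on \<open>k\<close>, so the bounds pass to the
    limit.\<close>
  have "dist_E U V \<le> 2 * \<alpha>"
    by (rule LIMSEQ_le_const[OF lim])
      (use dist_E_le[OF stiefel_joinable_subdivided[OF assms(1-3) \<alpha>]] in blast)
  then show ?thesis by (simp add: \<alpha>_def)
qed

section \<open>Lower bound for the distance\<close>

text \<open>A column moves on the unit sphere at most as fast as the whole matrix, and its angle to
  the starting position grows no faster than it moves.\<close>

lemma curve_length_ge_column_angle:
  fixes \<gamma> :: "real \<Rightarrow> real ^ 'p ^ 'n"
  assumes C1: "C1_curve \<gamma>" and st: "\<gamma> ` {0..1} \<subseteq> stiefel"
  shows "arccos (column i (\<gamma> 0) \<bullet> column i (\<gamma> 1)) \<le> curve_length \<gamma>"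
proof -
  define \<gamma>' where "\<gamma>' t = vector_derivative \<gamma> (at t within {0..1})" for t
  define c where "c t = column i (\<gamma> t)" for t
  define c' where "c' t = column i (\<gamma>' t)" for t
  define u where "u = c 0"
  define g where "g t = u \<bullet> c t" for t
  have col: "bounded_linear (\<lambda>A :: real ^ 'p ^ 'n. column i A)"
    by (intro linear_conv_bounded_linear[THEN iffD1] linearI) (simp_all add: column_def vec_eq_iff)
  have \<gamma>': "(\<gamma> has_vector_derivative \<gamma>' t) (at t within {0..1})" if "t \<in> {0..1}" for t
    using C1 that unfolding C1_curve_def \<gamma>'_def differentiable_on_def
    by (simp add: vector_derivative_works[symmetric])
  have c': "(c has_vector_derivative c' t) (at t within {0..1})" if "t \<in> {0..1}" for t
    unfolding c_def c'_def by (rule bounded_linear.has_vector_derivative[OF col \<gamma>'[OF that]])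
  have c'_le: "norm (c' t) \<le> norm (\<gamma>' t)" for t
    unfolding c'_def column_def using Finite_Cartesian_Product.norm_nth_le[of "transpose (\<gamma>' t)" i]
    by (simp add: norm_transpose) (simp add: transpose_def)
  have cc: "c t \<bullet> c t = 1" if "t \<in> {0..1}" for t
    using st that frames_norm[of "transpose (\<gamma> t)" i] unfolding stiefel_iff_frames
    by (auto simp: c_def column_def transpose_def norm_eq_1 image_subset_iff stiefel_iff_frames)
  \<comment> \<open>Obtained by differentiating the constant
    \<open>c t \<bullet> c t\<close>.\<close>
  have cc': "c t \<bullet> c' t = 0" if "t \<in> {0..1}" for t
  proof -
    have "((\<lambda>t. c t \<bullet> c t) has_vector_derivative (c t \<bullet> c' t + c' t \<bullet> c t)) (at t within {0..1})"
      using bounded_bilinear.has_vector_derivative[OF bounded_bilinear_inner c'[OF that] c'[OF that]] .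
    moreover have "((\<lambda>t. c t \<bullet> c t) has_vector_derivative 0) (at t within {0..1})"
      by (rule has_vector_derivative_transform[OF that _ has_vector_derivative_const[of 1]]) (simp add: cc)
    ultimately have "c t \<bullet> c' t + c' t \<bullet> c t = 0"
      using vector_derivative_unique_within_closed_interval[of 0 1 t] that by (auto simp: box_real)
    then show ?thesis by (simp add: inner_commute)
  qed
  have uu: "u \<bullet> u = 1" using cc[of 0] by (simp add: u_def)
  have g': "(g has_real_derivative u \<bullet> c' t) (at t within {0..1})" if "t \<in> {0..1}" for t
    unfolding has_real_derivative_iff_has_vector_derivative g_def
    by (rule bounded_linear.has_vector_derivative[OF bounded_linear_inner_right c'[OF that]])
  have g_sq: "(g t)\<^sup>2 \<le> 1" if "t \<in> {0..1}" for t
    using Cauchy_Schwarz_ineq[of u "c t"] cc[OF that] uu by (simp add: g_def)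
  have g'_le: "\<bar>u \<bullet> c' t\<bar> \<le> sqrt (1 - (g t)\<^sup>2) * norm (\<gamma>' t)" if "t \<in> {0..1}" for t
  proof -
    \<comment> \<open>As \<open>c' t\<close> is orthogonal to \<open>c t\<close>, the vector
      \<open>u\<close> may be replaced by its part orthogonal to \<open>c t\<close>, which makes the
      Cauchy-Schwarz bound sharp enough.\<close>
    have "u \<bullet> c' t = (u - g t *\<^sub>R c t) \<bullet> c' t"
      by (simp add: inner_simps cc'[OF that])
    moreover have "norm (u - g t *\<^sub>R c t) = sqrt (1 - (g t)\<^sup>2)"
      unfolding norm_eq_sqrt_inner using cc[OF that] uu
      by (simp add: inner_simps inner_commute g_def power2_eq_square)
    ultimately have "\<bar>u \<bullet> c' t\<bar> \<le> sqrt (1 - (g t)\<^sup>2) * norm (c' t)"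
      using Cauchy_Schwarz_ineq2[of "u - g t *\<^sub>R c t" "c' t"] by simp
    also have "\<dots> \<le> sqrt (1 - (g t)\<^sup>2) * norm (\<gamma>' t)"
      using c'_le g_sq[OF that] by (intro mult_left_mono) auto
    finally show ?thesis .
  qed
  have \<gamma>'_int: "(\<lambda>t. norm (\<gamma>' t)) integrable_on {0..1}"
    using C1 unfolding C1_curve_def \<gamma>'_def by (intro integrable_continuous_real continuous_on_norm) simp
  \<comment> \<open>The factor \<open>r < 1\<close> keeps the argument away from \<open>\<plusminus>1\<close>, where \<open>arccos\<close> is not differentiable.\<close>
  have bound: "arccos (r * g 1) - arccos (r * g 0) \<le> curve_length \<gamma>" if r: "0 < r" "r < 1" for r
  proof -
    have rg: "(r * g t)\<^sup>2 < 1" if "t \<in> {0..1}" for t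
    proof -
      have "(r * g t)\<^sup>2 \<le> r\<^sup>2 * 1"
        unfolding power_mult_distrib using g_sq[OF that] by (intro mult_left_mono) auto
      also have "\<dots> < 1" using r by (simp add: power_less_one_iff)
      finally show ?thesis .
    qed
    define h' where "h' t = - (r * (u \<bullet> c' t)) / sqrt (1 - (r * g t)\<^sup>2)" for t
    have "((\<lambda>t. arccos (r * g t)) has_vector_derivative h' t) (at t within {0..1})" if "t \<in> {0..1}" for t
    proof -
      have "-1 < r * g t" "r * g t < 1" using rg[OF that] by (auto simp: power2_less_1_iff abs_square_less_1)
      from DERIV_chain2[OF DERIV_arccos[OF this] DERIV_cmult[OF g'[OF that]]]
      show ?thesis
        unfolding has_real_derivative_iff_has_vector_derivative[symmetric] h'_def
        by (simp add: divide_inverse mult_ac)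
    qed
    then have "(h' has_integral arccos (r * g 1) - arccos (r * g 0)) {0..1}"
      by (intro fundamental_theorem_of_calculus) auto
    moreover have "((\<lambda>t. norm (\<gamma>' t)) has_integral curve_length \<gamma>) {0..1}"
      using \<gamma>'_int by (simp add: curve_length_def \<gamma>'_def integrable_integral)
    moreover have "h' t \<le> norm (\<gamma>' t)" if "t \<in> {0..1}" for t
    proof -
      have pos: "sqrt (1 - (r * g t)\<^sup>2) > 0" using rg[OF that] by simp
      \<comment> \<open>Moving \<open>r\<close> under the root turns 1 into \<open>r^2\<close>; as
        \<open>r < 1\<close>, the denominator of \<open>h' t\<close> dominates and only the speed
        remains.\<close>
      have "r * sqrt (1 - (g t)\<^sup>2) = sqrt (r\<^sup>2 - (r * g t)\<^sup>2)"
        using r real_sqrt_mult[of "r\<^sup>2" "1 - (g t)\<^sup>2"]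
        by (simp add: power_mult_distrib right_diff_distrib)
      also have "\<dots> \<le> sqrt (1 - (r * g t)\<^sup>2)"
        using r by (simp add: power_le_one)
      finally have "r * sqrt (1 - (g t)\<^sup>2) * norm (\<gamma>' t) \<le> sqrt (1 - (r * g t)\<^sup>2) * norm (\<gamma>' t)"
        by (intro mult_right_mono) auto
      moreover have "- (r * (u \<bullet> c' t)) \<le> r * (sqrt (1 - (g t)\<^sup>2) * norm (\<gamma>' t))"
        using g'_le[OF that] r mult_left_mono[of "- (u \<bullet> c' t)" "sqrt (1 - (g t)\<^sup>2) * norm (\<gamma>' t)" r] by auto
      ultimately have "- (r * (u \<bullet> c' t)) \<le> norm (\<gamma>' t) * sqrt (1 - (r * g t)\<^sup>2)"
        by (simp add: mult_ac)
      with pos show ?thesis unfolding h'_def by (simp only: pos_divide_le_eq)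
    qed
    ultimately show ?thesis by (rule has_integral_le)
  qed
  \<comment> \<open>Factors tending to 1; the shift by 2 makes already \<open>R 0\<close>
    positive.\<close>
  define R where "R n = 1 - 1 / real (n + 2)" for n :: nat
  have R: "0 < R n" "R n < 1" for n by (auto simp: R_def field_simps)
  have R_lim: "R \<longlonglongrightarrow> 1"
  proof -
    have "(\<lambda>n. 1 - 1 / real (n + 2)) \<longlonglongrightarrow> 1 - 0"
      by (intro tendsto_diff tendsto_const LIMSEQ_ignore_initial_segment lim_1_over_n)
    then show ?thesis by (simp add: R_def[abs_def])
  qed
  have arccos_lim: "(\<lambda>n. arccos (R n * g t)) \<longlonglongrightarrow> arccos (1 * g t)" if "t \<in> {0..1}" for t
  proof (rule continuous_on_tendsto_compose[OF continuous_on_arccos'])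
    show "(\<lambda>n. R n * g t) \<longlonglongrightarrow> 1 * g t" by (intro tendsto_mult tendsto_const R_lim)
    have "\<bar>g t\<bar> \<le> 1" using g_sq[OF that] by (simp add: abs_square_le_1)
    then show "1 * g t \<in> {-1..1}" by auto
    have "\<bar>R n * g t\<bar> \<le> 1" for n
      unfolding abs_mult using R[of n] \<open>\<bar>g t\<bar> \<le> 1\<close> by (intro mult_le_one) auto
    then show "\<forall>\<^sub>F n in sequentially. R n * g t \<in> {-1..1}"
      by (intro always_eventually allI) (auto simp: abs_le_iff)
  qed
  \<comment> \<open>The limit of \<open>bound\<close> as \<open>r\<close> tends to 1; the subtracted
    term is \<open>arccos 1 = 0\<close>.\<close>
  have "arccos (1 * g 1) - arccos (1 * g 0) \<le> curve_length \<gamma>"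
    by (rule LIMSEQ_le_const2[OF tendsto_diff[OF arccos_lim arccos_lim]]) (use bound R in auto)
  moreover have "g 0 = 1" using uu by (simp add: g_def u_def)
  ultimately show ?thesis by (simp add: g_def u_def c_def)
qed

lemma dist_E_lower_bound:
  fixes U V :: "real ^ 'p ^ 'n"
  assumes card: "CARD('p) < CARD('n)" and "U \<in> stiefel" "V \<in> stiefel" and "norm (U - V) \<le> 2"
  shows "arccos (column i U \<bullet> column i V) \<le> dist_E U V"
  unfolding dist_E_def
proof (rule cInf_greatest)
  define \<alpha> where "\<alpha> = arcsin (norm (U - V) / 2)"
  have \<alpha>: "0 \<le> \<alpha>" "\<alpha> \<le> pi / 2" "norm (U - V) \<le> 2 * sin \<alpha>"
    unfolding \<alpha>_def using half_chord_angle[OF norm_ge_zero assms(4)] by simp_all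
  \<comment> \<open>A lower bound for all lengths bounds the real infimum only if some admissible
    curve exists; the subdivided chords provide one.\<close>
  show "{curve_length \<gamma> |\<gamma>. C1_curve \<gamma> \<and> \<gamma> ` {0..1} \<subseteq> stiefel \<and> \<gamma> 0 = U \<and> \<gamma> 1 = V} \<noteq> {}"
    using joinable_C1_curve[OF stiefel_joinable_subdivided[OF assms(1-3) \<alpha>]] by blast
next
  fix l assume "l \<in> {curve_length \<gamma> |\<gamma>. C1_curve \<gamma> \<and> \<gamma> ` {0..1} \<subseteq> stiefel \<and> \<gamma> 0 = U \<and> \<gamma> 1 = V}"
  then show "arccos (column i U \<bullet> column i V) \<le> l"
    using curve_length_ge_column_angle by blast
qed

section \<open>Pairs that attain the bound\<close>

lemma stiefel_dist_attained:
  fixes U :: "real ^ 'p ^ 'n"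
  assumes card: "CARD('p) < CARD('n)" and U: "U \<in> stiefel" and \<delta>: "\<delta> \<in> {0..2}"
  obtains V where "V \<in> stiefel" "norm (U - V) = \<delta>" "dist_E U V = 2 * arcsin (\<delta> / 2)"
proof -
  fix k :: 'p
  define \<theta> where "\<theta> = 2 * arcsin (\<delta> / 2)"
  have \<theta>: "0 \<le> \<theta>" "\<theta> \<le> pi" "sin (\<theta> / 2) = \<delta> / 2"
    using half_chord_angle[of \<delta>] \<delta> by (simp_all add: \<theta>_def)
  have cos: "cos \<theta> = 1 - \<delta>\<^sup>2 / 2"
    using cos_double_sin[of "\<theta> / 2"] \<theta>(3) by (simp add: power_divide)
  define W where "W = transpose U"
  have W: "W \<in> frames" using U by (simp add: W_def flip: stiefel_iff_frames)
  obtain w where w: "norm w = 1" "\<And>i. w \<bullet> W $ i = 0" "\<And>i. W $ i \<bullet> w = 0"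
    using frames_orthogonal_unit[OF card, of W] by (metis inner_commute)
  \<comment> \<open>Column \<open>k\<close> is rotated by \<open>\<theta>\<close> towards
    \<open>w\<close>. Only this column moves, so the chordal distance of the frames is that of two
    unit vectors at angle \<open>\<theta>\<close>.\<close>
  define v where "v = cos \<theta> *\<^sub>R W $ k + sin \<theta> *\<^sub>R w"
  define X where "X = (\<chi> i. if i = k then v else W $ i)"
  have vv: "v \<bullet> v = 1" "W $ k \<bullet> v = cos \<theta>"
    using w frames_norm[OF W, of k] sin_cos_squared_add3[of \<theta>]
    by (simp_all add: v_def inner_simps norm_eq_1 add.commute)
  have vo: "v \<bullet> W $ i = 0 \<and> W $ i \<bullet> v = 0" if "i \<noteq> k" for i
    using W that w by (simp add: v_def inner_simps frames_def)
  have X: "X \<in> frames"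
    using W vv(1) vo by (auto simp: frames_def X_def)
  have "(norm (W - X))\<^sup>2 = (\<Sum>i\<in>UNIV. if i = k then (norm (W $ k - v))\<^sup>2 else 0)"
    unfolding norm_vec_sq by (intro sum.cong) (auto simp: X_def)
  also have "\<dots> = (W $ k - v) \<bullet> (W $ k - v)"
    by (simp add: sum.delta power2_norm_eq_inner)
  also have "\<dots> = 2 - 2 * cos \<theta>"
    using vv frames_norm[OF W, of k] by (simp add: inner_simps norm_eq_1 inner_commute)
  also have "\<dots> = \<delta>\<^sup>2" by (simp add: cos)
  finally have nWX: "norm (W - X) = \<delta>" using \<delta> by (simp add: power2_eq_iff_nonneg)
  define V where "V = transpose X"
  have V: "V \<in> stiefel" using X by (simp add: V_def stiefel_iff_frames)
  have nUV: "norm (U - V) = \<delta>"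
    using nWX norm_transpose[of "W - X"] by (simp add: W_def V_def transpose_def vec_eq_iff minus_vec_def)
  have "column k U \<bullet> column k V = cos \<theta>"
    using vv(2) by (simp add: V_def W_def[symmetric] X_def flip: row_transpose) (simp add: row_def)
  \<comment> \<open>Since \<open>\<theta>\<close> lies between 0 and \<open>pi\<close>,
    \<open>arccos\<close> recovers it from its cosine.\<close>
  then have "\<theta> \<le> dist_E U V"
    using dist_E_lower_bound[OF card U V, of k] nUV \<delta> \<theta> arccos_cos[of \<theta>] by simp
  moreover have "dist_E U V \<le> \<theta>"
    using dist_E_upper_bound[OF card U V] nUV \<delta> by (simp add: \<theta>_def)
  ultimately show ?thesis using that V nUV \<theta>_def by force
qed

text \<open>Distinct coordinate vectors form a frame. A starting point \<open>U\<close> is needed to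
  show that the distance bound belongs to \<open>dists_E\<close>.\<close>

lemma stiefel_nonempty:
  assumes "CARD('p) \<le> CARD('n)"
  shows "(stiefel :: (real ^ 'p ^ 'n) set) \<noteq> {}"
proof -
  obtain e :: "'p \<Rightarrow> 'n" where "inj e"
    using assms card_le_inj[of "UNIV :: 'p set" "UNIV :: 'n set"] by auto
  then have "(\<chi> i. axis (e i) 1) \<in> (frames :: (real ^ 'n ^ 'p) set)"
    by (auto simp: frames_def inner_axis_axis inj_eq)
  then have "transpose (\<chi> i. axis (e i) 1) \<in> (stiefel :: (real ^ 'p ^ 'n) set)"
    by (simp add: stiefel_iff_frames)
  then show ?thesis by blast
qed

text \<open>\<open>GREATEST\<close> is unspecified without a maximum, hence the separate clause that
  one exists. The upper bound holds for all pairs and is attained, so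
  \<open>2 * arcsin (\<delta> / 2)\<close> is the greatest element.\<close>

theorem corollary6p13:
  assumes "CARD('n::finite) \<ge> 2 * CARD('p::finite)"
  shows "(\<forall>U \<in> (stiefel :: (real ^ 'p ^ 'n) set). \<forall>\<delta> \<in> {0..2}.
            \<exists>V \<in> stiefel. norm (U - V) = \<delta> \<and> dist_E U V = 2 * arcsin (norm (U - V) / 2)) \<and>
         (\<forall>\<delta> \<in> {0..2}.
            (\<exists>m \<in> dists_E TYPE('n) TYPE('p) \<delta>. \<forall>d \<in> dists_E TYPE('n) TYPE('p) \<delta>. d \<le> m) \<and>
            M_E_hat \<delta> = M_E TYPE('n) TYPE('p) \<delta>)"
proof -
  have card: "CARD('p) < CARD('n)"
    using assms zero_less_card_finite[where 'a='p] by linarith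
  have attained: "\<exists>V\<in>stiefel. norm (U - V) = \<delta> \<and> dist_E U V = 2 * arcsin (norm (U - V) / 2)"
    if "U \<in> stiefel" "\<delta> \<in> {0..2}" for U :: "real ^ 'p ^ 'n" and \<delta>
    using stiefel_dist_attained[OF card that] by metis
  have ub: "d \<le> 2 * arcsin (\<delta> / 2)" if "d \<in> dists_E TYPE('n) TYPE('p) \<delta>" "\<delta> \<in> {0..2}" for d \<delta>
    using that dist_E_upper_bound[OF card] by (auto simp: dists_E_def norm_minus_commute)
  have mem: "2 * arcsin (\<delta> / 2) \<in> dists_E TYPE('n) TYPE('p) \<delta>" if \<delta>: "\<delta> \<in> {0..2}" for \<delta>
  proof -
    obtain U :: "real ^ 'p ^ 'n" where "U \<in> stiefel"
      using stiefel_nonempty card by (metis less_imp_le all_not_in_conv)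
    moreover from attained[OF this \<delta>] obtain V where "V \<in> stiefel" "norm (U - V) = \<delta>"
        "dist_E U V = 2 * arcsin (norm (U - V) / 2)" by blast
    ultimately show ?thesis
      unfolding dists_E_def mem_Collect_eq by (metis norm_minus_commute)
  qed
  have "M_E TYPE('n) TYPE('p) \<delta> = 2 * arcsin (\<delta> / 2)" if "\<delta> \<in> {0..2}" for \<delta>
    unfolding M_E_def using mem[OF that] ub[OF _ that] by (rule Greatest_equality)
  then have "M_E_hat \<delta> = M_E TYPE('n) TYPE('p) \<delta>" if "\<delta> \<in> {0..2}" for \<delta>
    using that by (simp add: M_E_hat_def)
  with attained mem ub show ?thesis by blast
qed

end
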